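(* Suppose that $U\subseteq\mathbb{R}^N$ is open, $1\le p<\infty$, $0<s_1<s_2<1$, and $\sigma:U\to(0,\infty]$ is a screening function. If $f\in\tilde{W}^{s_1,p}_{(\sigma)}(U)\cap\tilde{W}^{s_2,p}_{(\sigma)}(U)$ and $s=\theta s_1+(1-\theta)s_2$ for some $\theta\in(0,1)$, then $f\in\tilde{W}^{s,p}_{(\sigma)}(U)$ and $$|f|_{\tilde{W}^{s,p}_{(\sigma)}(U)}\le\left(|f|_{\tilde{W}^{s_1,p}_{(\sigma)}(U)}\right)^\theta\left(|f|_{\tilde{W}^{s_2,p}_{(\sigma)}(U)}\right)^{1-\theta}.$$
   Context: A screening function on an open set $U\subseteq\mathbb{R}^N$ is a lower semicontinuous function $\sigma:U\to(0,\infty]$. For $0<s<1$ and $f\in L^1_{\mathrm{loc}}(U)$, $$|f|_{\tilde{W}^{s,p}_{(\sigma)}(U)}:=\left(\int_U\int_{B(x,\sigma(x))\cap U}\frac{|f(y)-f(x)|^p}{|y-x|^{sp+N}}\,dy\,dx\right)^{1/p},$$ where $B(x,r)$ is the open ball (with $B(x,\infty)=\mathbb{R}^N$), and $\tilde{W}^{s,p}_{(\sigma)}(U)$ is the space of $f\in L^1_{\mathrm{loc}}(U)$ for which this is finite. *)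

theory Defs
  imports "HOL-Analysis.Analysis"
begin

definition lower_semicontinuous_on :: "'a::topological_space set \<Rightarrow> ('a \<Rightarrow> ereal) \<Rightarrow> bool" where
  "lower_semicontinuous_on U \<sigma> \<longleftrightarrow>
     (\<forall>x\<in>U. \<forall>t. t < \<sigma> x \<longrightarrow> (\<forall>\<^sub>F y in at x within U. t < \<sigma> y))"

definition screening_function :: "'a::euclidean_space set \<Rightarrow> ('a \<Rightarrow> ereal) \<Rightarrow> bool" where
  "screening_function U \<sigma> \<longleftrightarrow>
     open U \<and> (\<forall>x\<in>U. 0 < \<sigma> x) \<and> lower_semicontinuous_on U \<sigma>"

text \<open>On an open set \<open>U\<close> this includes measurability of \<open>f\<close> on \<open>U\<close>,
  as \<open>U\<close> is a countable union of compact sets.\<close>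

definition locally_integrable_on :: "('a::euclidean_space \<Rightarrow> real) \<Rightarrow> 'a set \<Rightarrow> bool" where
  "locally_integrable_on f U \<longleftrightarrow>
     (\<forall>K. compact K \<and> K \<subseteq> U \<longrightarrow> f absolutely_integrable_on K)"

text \<open>Power with positive real exponent on \<open>[0,\<infinity>]\<close>; \<open>\<infinity>\<close> is sent to \<open>\<infinity>\<close>,
  which is the right convention only for \<open>a > 0\<close>.\<close>

definition ennreal_powr :: "ennreal \<Rightarrow> real \<Rightarrow> ennreal" where
  "ennreal_powr x a = (if x = \<infinity> then \<infinity> else ennreal (enn2real x powr a))"

text \<open>The library's \<open>eball x r\<close> is \<open>{y. ereal (dist x y) < r}\<close>, hence all of the space
  for \<open>r = \<infinity>\<close>. On the diagonal \<open>y = x\<close>, a null set for the inner integral, the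
  quotient is \<open>0 / 0 = 0\<close>.\<close>

definition screened_seminorm ::
    "'a::euclidean_space set \<Rightarrow> ('a \<Rightarrow> ereal) \<Rightarrow> real \<Rightarrow> real \<Rightarrow> ('a \<Rightarrow> real) \<Rightarrow> ennreal" where
  "screened_seminorm U \<sigma> s p f =
     ennreal_powr
       (\<integral>\<^sup>+x\<in>U. (\<integral>\<^sup>+y\<in>eball x (\<sigma> x) \<inter> U.
           ennreal (\<bar>f y - f x\<bar> powr p / norm (y - x) powr (s * p + real DIM('a)))
         \<partial>lebesgue) \<partial>lebesgue)
       (1 / p)"

text \<open>Membership depends only on the values on \<open>U\<close>; functions agreeing almost everywhere on
  \<open>U\<close> are not identified.\<close>

definition screened_space ::
    "'a::euclidean_space set \<Rightarrow> ('a \<Rightarrow> ereal) \<Rightarrow> real \<Rightarrow> real \<Rightarrow> ('a \<Rightarrow> real) set" where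
  "screened_space U \<sigma> s p = {f. locally_integrable_on f U \<and> screened_seminorm U \<sigma> s p f < \<infinity>}"

end

theory Submission
  imports Defs
begin

text \<open>The integrand for exponent \<open>s\<close> is pointwise the weighted geometric mean of those for
  \<open>s\<^sub>1\<close> and \<open>s\<^sub>2\<close>, so the claim is Hoelder's inequality over
  \<open>{(x, y). x \<in> U, y \<in> U \<inter> B(x, \<sigma>(x))}\<close>. This set is open because \<open>\<sigma>\<close> is lower semicontinuous;
  after replacing \<open>f\<close> by an almost everywhere equal Borel function, the iterated integrals are
  integrals of Borel functions over the product space.\<close>

text \<open>Hoelder's inequality with conjugate exponents \<open>1 / \<theta>\<close> and
  \<open>1 / (1 - \<theta>)\<close>: after division of \<open>F\<close> and \<open>G\<close> by
  their integrals it follows from the weighted inequality between arithmetic and geometric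
  mean.\<close>

lemma nn_integral_powr_mult_powr_le:
  fixes F G :: "'a \<Rightarrow> real"
  assumes [measurable]: "F \<in> borel_measurable M" "G \<in> borel_measurable M"
    and nonneg: "\<And>x. 0 \<le> F x" "\<And>x. 0 \<le> G x"
    and A: "(\<integral>\<^sup>+x. ennreal (F x) \<partial>M) = ennreal A" "0 \<le> A"
    and B: "(\<integral>\<^sup>+x. ennreal (G x) \<partial>M) = ennreal B" "0 \<le> B"
    and \<theta>: "0 < \<theta>" "\<theta> < 1"
  shows "(\<integral>\<^sup>+x. ennreal (F x powr \<theta> * G x powr (1 - \<theta>)) \<partial>M)
    \<le> ennreal (A powr \<theta> * B powr (1 - \<theta>))"
proof (cases "A = 0 \<or> B = 0")
  \<comment> \<open>Normalising would divide by zero here; instead one factor vanishes almost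
    everywhere, and the product with it since \<open>0 powr a = 0\<close>.\<close>
  case True
  then have "(AE x in M. F x = 0) \<or> (AE x in M. G x = 0)"
    using A B nonneg by (auto simp: nn_integral_0_iff_AE ennreal_eq_0_iff antisym_conv)
  then have "AE x in M. ennreal (F x powr \<theta> * G x powr (1 - \<theta>)) = 0"
    by (auto elim: eventually_mono)
  then show ?thesis
    using nn_integral_cong_AE[of _ "\<lambda>_. 0" M] by simp
next
  case False
  with A B have pos: "A > 0" "B > 0" by auto
  \<comment> \<open>\<open>C\<close> is the claimed bound. Young's inequality for
    \<open>F x / A\<close> and \<open>G x / B\<close>, multiplied by \<open>C\<close>, bounds the
    product linearly in \<open>F\<close> and \<open>G\<close>; this bound integrates to
    \<open>C * \<theta> + C * (1 - \<theta>) = C\<close>.\<close>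
  define C where "C = A powr \<theta> * B powr (1 - \<theta>)"
  have "F x powr \<theta> * G x powr (1 - \<theta>) \<le> (C * \<theta> / A) * F x + (C * (1 - \<theta>) / B) * G x" for x
  proof (cases "F x = 0 \<or> G x = 0")
    case True
    then show ?thesis
      using \<theta> pos nonneg[of x] by (auto simp: C_def)
  next
    case False
    then have "0 < F x" "0 < G x"
      using nonneg[of x] by auto
    then have "(F x / A) powr \<theta> * (G x / B) powr (1 - \<theta>)
        \<le> \<theta> * (F x / A) + (1 - \<theta>) * (G x / B)"
      using \<theta> pos by (intro Youngs_inequality_0) auto
    then have "C * ((F x / A) powr \<theta> * (G x / B) powr (1 - \<theta>))
        \<le> C * (\<theta> * (F x / A) + (1 - \<theta>) * (G x / B))"
      by (intro mult_left_mono) (auto simp: C_def)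
    moreover have "C * ((F x / A) powr \<theta> * (G x / B) powr (1 - \<theta>))
        = F x powr \<theta> * G x powr (1 - \<theta>)"
      using pos nonneg[of x] by (simp add: C_def powr_divide)
    ultimately show ?thesis
      by (simp add: algebra_simps)
  qed
  then have "(\<integral>\<^sup>+x. ennreal (F x powr \<theta> * G x powr (1 - \<theta>)) \<partial>M)
      \<le> (\<integral>\<^sup>+x. ennreal ((C * \<theta> / A) * F x + (C * (1 - \<theta>) / B) * G x) \<partial>M)"
    by (intro nn_integral_mono ennreal_leI)
  also have "\<dots> = (\<integral>\<^sup>+x. ennreal (C * \<theta> / A) * ennreal (F x)
      + ennreal (C * (1 - \<theta>) / B) * ennreal (G x) \<partial>M)"
    using pos \<theta> nonneg
    by (intro nn_integral_cong) (simp add: C_def ennreal_mult' flip: ennreal_plus ennreal_mult)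
  also have "\<dots> = ennreal (C * \<theta> / A) * ennreal A + ennreal (C * (1 - \<theta>) / B) * ennreal B"
    by (simp add: nn_integral_add nn_integral_cmult A B)
  also have "\<dots> = ennreal ((C * \<theta> / A) * A + (C * (1 - \<theta>) / B) * B)"
    using pos \<theta> by (simp add: C_def flip: ennreal_plus ennreal_mult)
  also have "(C * \<theta> / A) * A + (C * (1 - \<theta>) / B) * B = C"
    using pos by (simp add: field_simps)
  finally show ?thesis
    by (simp add: C_def)
qed

text \<open>Along an exhaustion of \<open>U\<close> by compact sets, the truncations of
  \<open>f\<close> are Lebesgue measurable and converge pointwise to \<open>f\<close> cut off
  outside \<open>U\<close>. A Lebesgue measurable function has a Borel version.\<close>

lemma locally_integrable_on_AE_eq_borel:
  fixes f :: "'a::euclidean_space \<Rightarrow> real"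
  assumes "open U" and f: "locally_integrable_on f U"
  obtains g where "g \<in> borel_measurable borel" "AE x in lborel. x \<in> U \<longrightarrow> f x = g x"
proof -
  obtain C where C: "\<And>n::nat. compact (C n)" "\<And>n. C n \<subseteq> U"
      "\<And>n. C n \<subseteq> interior (C (Suc n))" "\<Union>(range C) = U"
    using open_Union_compact_subsets[OF \<open>open U\<close>] by metis
  have "incseq C"
    using C(3) interior_subset by (intro incseq_SucI) blast
  have "(\<lambda>x. indicator U x * f x) \<in> borel_measurable lebesgue"
  proof (rule borel_measurable_LIMSEQ_real)
    show "(\<lambda>x. indicator (C n) x * f x) \<in> borel_measurable lebesgue" for n
      using f C(1,2) unfolding locally_integrable_on_def set_integrable_def
      by (auto dest!: borel_measurable_integrable)
    show "(\<lambda>n. indicator (C n) x * f x) \<longlonglongrightarrow> indicator U x * f x" for x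
      using LIMSEQ_indicator_incseq[OF \<open>incseq C\<close>, of x] C(4) by (intro tendsto_mult) auto
  qed
  then obtain g where "g \<in> borel_measurable lborel" "AE x in lborel. indicator U x * f x = g x"
    using completion_ex_borel_measurable_real by blast
  then show thesis
    by (intro that[of g]) (auto elim!: eventually_mono)
qed

text \<open>Given \<open>(x, y)\<close> in the region, pick \<open>t\<close> strictly between
  \<open>dist x y\<close> and \<open>\<sigma> x\<close>. Semicontinuity keeps
  \<open>\<sigma>\<close> above \<open>t\<close> near \<open>x\<close>, and having distance below
  \<open>t\<close> is an open condition on pairs.\<close>

lemma open_screened_region:
  fixes \<sigma> :: "'a::euclidean_space \<Rightarrow> ereal"
  assumes "open U" and lsc: "lower_semicontinuous_on U \<sigma>"
  shows "open {(x, y). x \<in> U \<and> y \<in> eball x (\<sigma> x) \<inter> U}" (is "open ?W")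
proof (subst open_subopen, safe)
  fix x y
  assume xy: "x \<in> U" "y \<in> eball x (\<sigma> x)" "y \<in> U"
  then obtain t where t: "dist x y < t" "ereal t < \<sigma> x"
    using ereal_dense2[of "dist x y" "\<sigma> x"] by auto
  then have "\<forall>\<^sub>F z in at x within U. ereal t < \<sigma> z"
    using lsc xy by (auto simp: lower_semicontinuous_on_def)
  \<comment> \<open>The filter \<open>at x within U\<close> leaves out \<open>x\<close> itself;
    there the bound is the choice of \<open>t\<close>.\<close>
  then obtain A where A: "open A" "x \<in> A" "\<And>z. z \<in> A \<Longrightarrow> z \<in> U \<Longrightarrow> t < \<sigma> z"
    using t by (auto simp: eventually_at_topological) metis
  let ?T = "((A \<inter> U) \<times> U) \<inter> {z. dist (fst z) (snd z) < t}"
  have "open ?T"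
    using A \<open>open U\<close> by (intro open_Int open_Times open_Collect_less continuous_intros) auto
  moreover have "?T \<subseteq> ?W"
    using A(3) by (auto intro: less_trans[of "ereal _" "ereal t"])
  ultimately show "\<exists>T. open T \<and> (x, y) \<in> T \<and> T \<subseteq> ?W"
    using A xy t by (intro exI[of _ ?T]) auto
qed

text \<open>Tonelli needs an integrand measurable for the product of the Borel algebras, hence the
  passage from \<open>f\<close> to \<open>g\<close>. The exceptional null set is discarded twice: in
  \<open>x\<close> for the outer integral, and in \<open>y\<close>, with \<open>x\<close> fixed, for
  the inner one.\<close>

lemma nn_integral_screened_eq_pair:
  fixes f g :: "'a::euclidean_space \<Rightarrow> real" and \<sigma> :: "'a \<Rightarrow> ereal" and U :: "'a set"
  defines "W \<equiv> {(x, y). x \<in> U \<and> y \<in> eball x (\<sigma> x) \<inter> U}"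
  assumes "open U" and lsc: "lower_semicontinuous_on U \<sigma>"
    and [measurable]: "g \<in> borel_measurable borel"
    and fg: "AE x in lborel. x \<in> U \<longrightarrow> f x = g x"
  shows "(\<integral>\<^sup>+x\<in>U. (\<integral>\<^sup>+y\<in>eball x (\<sigma> x) \<inter> U.
           ennreal (\<bar>f y - f x\<bar> powr p / norm (y - x) powr r) \<partial>lebesgue) \<partial>lebesgue)
    = (\<integral>\<^sup>+z. ennreal (indicator W z
           * (\<bar>g (snd z) - g (fst z)\<bar> powr p / norm (snd z - fst z) powr r)) \<partial>(lborel \<Otimes>\<^sub>M lborel))"
    (is "?L = (\<integral>\<^sup>+z. ?h z \<partial>_)")
proof -
  have [measurable]: "W \<in> sets (borel \<Otimes>\<^sub>M borel)"
    using borel_open[OF open_screened_region[OF \<open>open U\<close> lsc]] 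
    unfolding W_def borel_prod .
  have "?L = (\<integral>\<^sup>+x. \<integral>\<^sup>+y. ?h (x, y) \<partial>lborel \<partial>lborel)"
    \<comment> \<open>Integrals over \<open>lebesgue\<close>, the completion of
      \<open>lborel\<close>, become integrals over \<open>lborel\<close>.\<close>
    unfolding nn_integral_completion
  proof (rule nn_integral_cong_AE, use fg in eventually_elim)
    fix x
    assume x: "x \<in> U \<longrightarrow> f x = g x"
    show "(\<integral>\<^sup>+y\<in>eball x (\<sigma> x) \<inter> U. ennreal (\<bar>f y - f x\<bar> powr p / norm (y - x) powr r) \<partial>lborel)
        * indicator U x = (\<integral>\<^sup>+y. ?h (x, y) \<partial>lborel)"
    proof (cases "x \<in> U")
      case True
      have "(\<integral>\<^sup>+y\<in>eball x (\<sigma> x) \<inter> U. ennreal (\<bar>f y - f x\<bar> powr p / norm (y - x) powr r) \<partial>lborel)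
          = (\<integral>\<^sup>+y. ?h (x, y) \<partial>lborel)"
        by (rule nn_integral_cong_AE, use fg in eventually_elim)
          (use x True in \<open>auto simp: W_def indicator_def\<close>)
      with True show ?thesis by simp
    qed (simp add: W_def)
  qed
  also have "\<dots> = (\<integral>\<^sup>+z. ?h z \<partial>(lborel \<Otimes>\<^sub>M lborel))"
    by (rule lborel.nn_integral_fst) measurable
  finally show ?thesis .
qed

theorem proposition3p8:
  fixes U :: "'a::euclidean_space set"
    and \<sigma> :: "'a \<Rightarrow> ereal"
    and f :: "'a \<Rightarrow> real"
    and p s s1 s2 \<theta> :: real
  assumes "open U"
    and "1 \<le> p"
    and "0 < s1" and "s1 < s2" and "s2 < 1"
    and "screening_function U \<sigma>"
    and "f \<in> screened_space U \<sigma> s1 p \<inter> screened_space U \<sigma> s2 p"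
    and "0 < \<theta>" and "\<theta> < 1"
    and "s = \<theta> * s1 + (1 - \<theta>) * s2"
  shows "f \<in> screened_space U \<sigma> s p \<and>
    screened_seminorm U \<sigma> s p f
      \<le> ennreal_powr (screened_seminorm U \<sigma> s1 p f) \<theta>
         * ennreal_powr (screened_seminorm U \<sigma> s2 p f) (1 - \<theta>)"
proof -
  have lsc: "lower_semicontinuous_on U \<sigma>" and loc: "locally_integrable_on f U"
    using assms by (auto simp: screening_function_def screened_space_def)
  obtain g where [measurable]: "g \<in> borel_measurable borel"
    and fg: "AE x in lborel. x \<in> U \<longrightarrow> f x = g x"
    using locally_integrable_on_AE_eq_borel[OF \<open>open U\<close> loc] .
  define W where "W = {(x, y). x \<in> U \<and> y \<in> eball x (\<sigma> x) \<inter> U}"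
  have [measurable]: "W \<in> sets (borel \<Otimes>\<^sub>M borel)"
    using borel_open[OF open_screened_region[OF \<open>open U\<close> lsc]] 
    unfolding W_def borel_prod .
  define h where "h t z = indicator W z * (\<bar>g (snd z) - g (fst z)\<bar> powr p
    / norm (snd z - fst z) powr (t * p + real DIM('a)))" for t and z :: "'a \<times> 'a"
  have h_nonneg: "0 \<le> h t z" for t z
    by (simp add: h_def)
  have [measurable]: "h t \<in> borel_measurable (lborel \<Otimes>\<^sub>M lborel)" for t
    unfolding h_def by measurable
  define I where "I t = (\<integral>\<^sup>+z. ennreal (h t z) \<partial>(lborel \<Otimes>\<^sub>M lborel))" for t
  have seminorm: "screened_seminorm U \<sigma> t p f = ennreal_powr (I t) (1 / p)" for t
    unfolding screened_seminorm_def I_def h_def W_def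
    by (subst nn_integral_screened_eq_pair[OF \<open>open U\<close> lsc _ fg]) auto
  \<comment> \<open>\<open>ennreal_powr\<close> keeps the value \<open>\<infinity>\<close>, so a
    finite seminorm forces a finite double integral.\<close>
  have "I s1 < \<infinity>" "I s2 < \<infinity>"
    using assms(7) by (auto simp: screened_space_def seminorm ennreal_powr_def less_top split: if_splits)
  then obtain A B where A: "I s1 = ennreal A" "0 \<le> A" and B: "I s2 = ennreal B" "0 \<le> B"
    by (metis ennreal_cases infinity_ennreal_def less_irrefl)
  \<comment> \<open>The numerator splits as
    \<open>a = a powr \<theta> * a powr (1 - \<theta>)\<close>, and \<open>s * p + ?N\<close> is the
    same convex combination of the two given exponents because the weights sum to 1. For
    \<open>d = 0\<close> both sides are 0, by division by zero.\<close>
  have "h s z = h s1 z powr \<theta> * h s2 z powr (1 - \<theta>)" for z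
  proof -
    define a d where "a = \<bar>g (snd z) - g (fst z)\<bar> powr p" and "d = norm (snd z - fst z)"
    let ?N = "real DIM('a)"
    have "0 \<le> a" "0 \<le> d"
      by (auto simp: a_def d_def)
    moreover have "a powr \<theta> * a powr (1 - \<theta>) = a"
      using \<open>0 \<le> a\<close> by (simp flip: powr_add)
    ultimately have "a / d powr (k1 * \<theta> + k2 * (1 - \<theta>))
        = (a / d powr k1) powr \<theta> * (a / d powr k2) powr (1 - \<theta>)" for k1 k2
      by (simp add: powr_divide powr_powr powr_add)
    moreover have "s * p + ?N = (s1 * p + ?N) * \<theta> + (s2 * p + ?N) * (1 - \<theta>)"
      unfolding assms(10) by (simp add: algebra_simps)
    ultimately have "a / d powr (s * p + ?N) = (a / d powr (s1 * p + ?N)) powr \<theta>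
        * (a / d powr (s2 * p + ?N)) powr (1 - \<theta>)"
      by metis
    then show ?thesis
      by (auto simp: h_def a_def d_def indicator_def)
  qed
  then have "I s \<le> ennreal (A powr \<theta> * B powr (1 - \<theta>))"
    unfolding I_def using A B assms(8,9) h_nonneg
    by (simp add: nn_integral_powr_mult_powr_le I_def)
  then obtain J where J: "I s = ennreal J" "0 \<le> J" "J \<le> A powr \<theta> * B powr (1 - \<theta>)"
    by (cases "I s") (auto simp: top_unique)
  \<comment> \<open>Taking the root of order \<open>p\<close> preserves the bound, and the exponents
    \<open>1 / p\<close> and \<open>\<theta>\<close> commute, which turns \<open>A\<close> and
    \<open>B\<close> into powers of the two seminorms.\<close>
  have "J powr (1 / p) \<le> (A powr \<theta> * B powr (1 - \<theta>)) powr (1 / p)"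
    using J assms(2) by (intro powr_mono2) auto
  also have "\<dots> = (A powr (1 / p)) powr \<theta> * (B powr (1 / p)) powr (1 - \<theta>)"
    by (simp add: powr_mult powr_powr mult.commute)
  finally have "screened_seminorm U \<sigma> s p f
      \<le> ennreal_powr (screened_seminorm U \<sigma> s1 p f) \<theta>
         * ennreal_powr (screened_seminorm U \<sigma> s2 p f) (1 - \<theta>)"
    using A B J by (simp add: seminorm ennreal_powr_def ennreal_leI flip: ennreal_mult)
  moreover have "screened_seminorm U \<sigma> s p f < \<infinity>"
    using J by (simp add: seminorm ennreal_powr_def)
  ultimately show ?thesis
    using loc by (simp add: screened_space_def)
qed

end
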